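(* Let $G$ be a $2$-connected nontrivial uniquely $C_9$-saturated graph whose longest even cycle of length at most $12$ has length $6$. Let $u,v$ be distinct nonadjacent vertices of $G$ with a common neighbour $w$. Then $w$ is an interior vertex of $P(u,v)$, and writing $P(u,v)=u\,A\,w\,B\,v$, where $A$ is the segment of $P(u,v)$ from $u$ to $w$ and $B$ the segment from $w$ to $v$, with $|A|,|B|$ their numbers of edges, we have $|A|\ge 2$ and $|B|\ge 2$; equivalently, the two neighbours of $w$ along $P(u,v)$ lie in $N(w)\setminus\{u,v\}$.
   Context: All graphs are finite and simple. A graph $G$ is uniquely $C_9$-saturated if it contains no cycle of length $9$ and, for every edge $e$ of the complement $\overline{G}$, $G+e$ contains exactly one cycle of length $9$; it is nontrivial if $|V(G)|\ge 9$. A $9$-path is a path on $9$ vertices (hence with $8$ edges). In a uniquely $C_9$-saturated graph every two distinct nonadjacent vertices $u,v$ are the endpoints of exactly one $9$-path, denoted $P(u,v)$. "Longest even cycle of length at most $12$" means a longest cycle among all even cycles of $G$ whose length is at most $12$; so here $G$ contains a $6$-cycle but no cycle of length $8$, $10$ or $12$. *)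

theory Defs
  imports Main
begin

text \<open>Edges are two-element sets of vertices; see \<open>simple_graph\<close>.\<close>

datatype 'a graph = Graph (vertices: "'a set") (edges: "'a set set")

definition simple_graph :: "'a graph \<Rightarrow> bool" where
  "simple_graph G \<longleftrightarrow>
     finite (vertices G) \<and> (\<forall>e \<in> edges G. e \<subseteq> vertices G \<and> card e = 2)"

definition adjacent :: "'a graph \<Rightarrow> 'a \<Rightarrow> 'a \<Rightarrow> bool" where
  "adjacent G x y \<longleftrightarrow> {x, y} \<in> edges G"

definition neighbourhood :: "'a graph \<Rightarrow> 'a \<Rightarrow> 'a set" where
  "neighbourhood G x = {y \<in> vertices G. adjacent G x y}"

definition subgraph :: "'a graph \<Rightarrow> 'a graph \<Rightarrow> bool" where
  "subgraph H G \<longleftrightarrow> vertices H \<subseteq> vertices G \<and> edges H \<subseteq> edges G"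

definition complement_graph :: "'a graph \<Rightarrow> 'a graph" where
  "complement_graph G =
     Graph (vertices G) {e. e \<subseteq> vertices G \<and> card e = 2 \<and> e \<notin> edges G}"

definition add_edge :: "'a graph \<Rightarrow> 'a set \<Rightarrow> 'a graph" where
  "add_edge G e = Graph (vertices G) (insert e (edges G))"

definition delete_vertices :: "'a graph \<Rightarrow> 'a set \<Rightarrow> 'a graph" where
  "delete_vertices G X = Graph (vertices G - X) {e \<in> edges G. e \<inter> X = {}}"

text \<open>A path is given by the list of its vertices in order, hence comes with a direction:
  for distinct \<open>u\<close> and \<open>v\<close>, the lists from \<open>u\<close> to \<open>v\<close> correspond bijectively to the path
  subgraphs with endpoints \<open>u\<close> and \<open>v\<close>.\<close>

fun path_edges :: "'a list \<Rightarrow> 'a set set" where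
  "path_edges (x # y # zs) = insert {x, y} (path_edges (y # zs))"
| "path_edges _ = {}"

definition is_path :: "'a graph \<Rightarrow> 'a list \<Rightarrow> bool" where
  "is_path G p \<longleftrightarrow>
     p \<noteq> [] \<and> distinct p \<and> set p \<subseteq> vertices G \<and> path_edges p \<subseteq> edges G"

definition path_between :: "'a graph \<Rightarrow> 'a \<Rightarrow> 'a \<Rightarrow> 'a list \<Rightarrow> bool" where
  "path_between G u v p \<longleftrightarrow> is_path G p \<and> hd p = u \<and> last p = v"

definition num_edges :: "'a list \<Rightarrow> nat" where
  "num_edges p = length p - 1"

definition interior_vertices :: "'a list \<Rightarrow> 'a set" where
  "interior_vertices p = set p - {hd p, last p}"

definition graph_connected :: "'a graph \<Rightarrow> bool" where
  "graph_connected G \<longleftrightarrow>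
     vertices G \<noteq> {} \<and> (\<forall>x \<in> vertices G. \<forall>y \<in> vertices G. \<exists>p. path_between G x y p)"

definition k_connected :: "nat \<Rightarrow> 'a graph \<Rightarrow> bool" where
  "k_connected k G \<longleftrightarrow>
     k < card (vertices G) \<and>
     (\<forall>X \<subseteq> vertices G. card X < k \<longrightarrow> graph_connected (delete_vertices G X))"

text \<open>Cycles are counted as subgraphs, so rotations and reversals of a vertex list
  describe the same cycle.\<close>

definition cycle_graph :: "'a list \<Rightarrow> 'a graph" where
  "cycle_graph xs = Graph (set xs) (insert {last xs, hd xs} (path_edges xs))"

definition cycle_of_length :: "nat \<Rightarrow> 'a graph \<Rightarrow> 'a graph \<Rightarrow> bool" where
  "cycle_of_length n G C \<longleftrightarrow>
     subgraph C G \<and> (\<exists>xs. distinct xs \<and> length xs = n \<and> 3 \<le> n \<and> C = cycle_graph xs)"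

definition uniquely_cycle_saturated :: "nat \<Rightarrow> 'a graph \<Rightarrow> bool" where
  "uniquely_cycle_saturated n G \<longleftrightarrow>
     (\<nexists>C. cycle_of_length n G C) \<and>
     (\<forall>e \<in> edges (complement_graph G). \<exists>!C. cycle_of_length n (add_edge G e) C)"

definition longest_even_cycle_upto :: "nat \<Rightarrow> 'a graph \<Rightarrow> nat \<Rightarrow> bool" where
  "longest_even_cycle_upto m G l \<longleftrightarrow>
     even l \<and> l \<le> m \<and> (\<exists>C. cycle_of_length l G C) \<and>
     (\<forall>k C. even k \<and> k \<le> m \<and> cycle_of_length k G C \<longrightarrow> k \<le> l)"

definition nine_path :: "'a graph \<Rightarrow> 'a \<Rightarrow> 'a \<Rightarrow> 'a list \<Rightarrow> bool" where
  "nine_path G u v p \<longleftrightarrow> path_between G u v p \<and> length p = 9"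

text \<open>The path \<open>P(u,v)\<close>, listed from \<open>u\<close> to \<open>v\<close>. It is meaningful for distinct nonadjacent
  \<open>u\<close>, \<open>v\<close> of a uniquely 9-cycle-saturated graph; see \<open>nine_path_unique\<close> below.\<close>

definition the_nine_path :: "'a graph \<Rightarrow> 'a \<Rightarrow> 'a \<Rightarrow> 'a list" where
  "the_nine_path G u v = (THE p. nine_path G u v p)"

lemma path_edges_append:
  "xs \<noteq> [] \<Longrightarrow> ys \<noteq> [] \<Longrightarrow>
     path_edges (xs @ ys) = insert {last xs, hd ys} (path_edges xs \<union> path_edges ys)"
proof (induction xs rule: path_edges.induct)
  case (1 x y zs) then show ?case by auto
next
  case ("2_2" x) then show ?case by (cases ys) auto
qed simp

lemma path_edges_rev: "path_edges (rev xs) = path_edges xs"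
proof (induction xs rule: path_edges.induct)
  case (1 x y zs)
  have "path_edges (rev (y # zs) @ [x]) = insert {y, x} (path_edges (rev (y # zs)))"
    by (subst path_edges_append) (auto simp: last_rev)
  then show ?case using 1 by (simp add: insert_commute)
qed auto

lemma path_edges_subset: "e \<in> path_edges xs \<Longrightarrow> e \<subseteq> set xs"
  by (induction xs rule: path_edges.induct) auto

lemma path_edges_split:
  "e \<in> path_edges xs \<Longrightarrow> \<exists>as a b bs. xs = as @ a # b # bs \<and> e = {a, b}"
proof (induction xs rule: path_edges.induct)
  case (1 x y zs)
  show ?case
  proof (cases "e = {x, y}")
    case True then show ?thesis by blast
  next
    case False
    then obtain as a b bs where "y # zs = as @ a # b # bs" "e = {a, b}"
      using 1 by auto
    then show ?thesis by (metis append_Cons)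
  qed
qed auto

lemma closing_edge_notin_path_edges:
  assumes "distinct xs" "3 \<le> length xs"
  shows "{hd xs, last xs} \<notin> path_edges xs"
proof
  assume "{hd xs, last xs} \<in> path_edges xs"
  then obtain as a b bs where *: "xs = as @ a # b # bs" "{hd xs, last xs} = {a, b}"
    using path_edges_split by metis
  show False
    using assms * by (cases as; cases bs rule: rev_cases) (auto simp: doubleton_eq_iff)
qed

lemma path_determined_by_edges:
  assumes "distinct p" "distinct q" "length p = length q" "p \<noteq> []" "hd p = hd q"
    "path_edges p = path_edges q"
  shows "p = q"
  using assms
proof (induction p arbitrary: q rule: path_edges.induct)
  case (1 x y zs)
  then obtain y' zs' where q: "q = x # y' # zs'"
    by (cases q rule: path_edges.cases) auto
  have nx: "{x, y} \<notin> path_edges (y' # zs')" "{x, y'} \<notin> path_edges (y # zs)"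
    "{x, y} \<notin> path_edges (y # zs)" "{x, y'} \<notin> path_edges (y' # zs')"
    using 1(2,3) q path_edges_subset by fastforce+
  have "{x, y} \<in> path_edges q" using 1(7) by auto
  then have "y = y'" using nx q by (auto simp: doubleton_eq_iff)
  moreover have "path_edges (y # zs) = path_edges (y' # zs')"
    using 1(7) nx q \<open>y = y'\<close> by (simp add: insert_ident)
  ultimately show ?case using 1(1)[of "y' # zs'"] 1(2-4) q by simp
next
  case ("2_2" x) then show ?case by (cases q) auto
qed simp

lemma cycle_graph_through_edge:
  assumes "distinct xs" "{u, v} \<in> edges (cycle_graph xs)" "3 \<le> length xs"
  shows "\<exists>p. distinct p \<and> length p = length xs \<and> hd p = u \<and> last p = v
           \<and> cycle_graph p = cycle_graph xs"
proof -
  have rot: "\<exists>q. distinct q \<and> length q = length xs \<and> {hd q, last q} = {u, v}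
           \<and> cycle_graph q = cycle_graph xs"
  proof (cases "{u, v} = {last xs, hd xs}")
    case True then show ?thesis using assms by (auto simp: insert_commute)
  next
    case False
    then have "{u, v} \<in> path_edges xs" using assms by (auto simp: cycle_graph_def)
    then obtain as a b bs where xs: "xs = as @ a # b # bs" and e: "{u, v} = {a, b}"
      using path_edges_split by metis
    have xs': "xs = (as @ [a]) @ (b # bs)" using xs by simp
    have "cycle_graph ((b # bs) @ (as @ [a])) = cycle_graph xs"
      unfolding cycle_graph_def xs'
      by (subst (1 2) path_edges_append) (auto simp: insert_commute hd_append)
    then show ?thesis using assms(1) xs e
      by (intro exI[of _ "(b # bs) @ (as @ [a])"]) (auto simp: insert_commute)
  qed
  then obtain q where q: "distinct q" "length q = length xs" "{hd q, last q} = {u, v}"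
    "cycle_graph q = cycle_graph xs" by blast
  have "cycle_graph (rev q) = cycle_graph q"
    by (simp add: cycle_graph_def path_edges_rev hd_rev last_rev insert_commute)
  then show ?thesis using q
    by (cases "hd q = u")
       (auto simp: doubleton_eq_iff hd_rev last_rev intro: exI[of _ q] exI[of _ "rev q"])
qed

lemma nine_path_unique:
  assumes sat: "uniquely_cycle_saturated 9 G"
    and uv: "u \<in> vertices G" "v \<in> vertices G" "u \<noteq> v" "\<not> adjacent G u v"
  shows "\<exists>!p. nine_path G u v p"
proof -
  let ?G' = "add_edge G {u, v}"
  have "{u, v} \<in> edges (complement_graph G)"
    using uv by (auto simp: complement_graph_def adjacent_def)
  then have ex1: "\<exists>!C. cycle_of_length 9 ?G' C"
    and no: "\<nexists>C. cycle_of_length 9 G C"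
    using sat by (auto simp: uniquely_cycle_saturated_def)
  have cyc: "cycle_of_length 9 ?G' (cycle_graph p)" if "nine_path G u v p" for p
    unfolding cycle_of_length_def
    using that by (auto simp: nine_path_def path_between_def is_path_def subgraph_def
        cycle_graph_def add_edge_def intro!: exI[of _ p])
  show ?thesis
  proof (rule ex_ex1I)
    obtain C where C: "cycle_of_length 9 ?G' C" using ex1 by blast
    then obtain xs where xs: "distinct xs" "length xs = 9" "C = cycle_graph xs"
      by (auto simp: cycle_of_length_def)
    have "{u, v} \<in> edges C"
    proof (rule ccontr)
      assume "{u, v} \<notin> edges C"
      then have "cycle_of_length 9 G C"
        using C by (auto simp: cycle_of_length_def subgraph_def add_edge_def)
      then show False using no by blast
    qed
    then obtain p where p: "distinct p" "length p = 9" "hd p = u" "last p = v"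
      "cycle_graph p = C"
      using cycle_graph_through_edge[of xs u v] xs by auto
    have "{u, v} \<notin> path_edges p" using closing_edge_notin_path_edges[of p] p by auto
    moreover have "set p \<subseteq> vertices G" "path_edges p \<subseteq> insert {u, v} (edges G)"
      using C unfolding p(5)[symmetric]
      by (simp_all add: cycle_of_length_def subgraph_def add_edge_def cycle_graph_def)
    ultimately show "\<exists>p. nine_path G u v p"
      using p by (auto simp: nine_path_def path_between_def is_path_def intro!: exI[of _ p])
  next
    fix p q assume pq: "nine_path G u v p" "nine_path G u v q"
    then have "cycle_graph p = cycle_graph q" using cyc ex1 by blast
    then have eq: "insert {u, v} (path_edges p) = insert {u, v} (path_edges q)"
      using pq by (auto simp: cycle_graph_def nine_path_def path_between_def insert_commute)
    have n: "{u, v} \<notin> path_edges p" "{u, v} \<notin> path_edges q"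
      using pq uv by (auto simp: nine_path_def path_between_def is_path_def adjacent_def)
    then have "path_edges p = path_edges q" using eq by (simp add: insert_ident)
    then show "p = q" using pq
      by (intro path_determined_by_edges)
         (auto simp: nine_path_def path_between_def is_path_def)
  qed
qed

end

theory Submission imports Defs begin

text \<open>The edges \<open>uw\<close> and \<open>vw\<close> close up \<open>P(u,v)\<close>, or a large part of it, to an even cycle.
  If \<open>w\<close> were off \<open>P(u,v)\<close>, the two edges and the path would form a cycle of length 10. If
  \<open>w\<close> were the vertex next to \<open>u\<close>, then the path without \<open>u\<close> is an 8-vertex path from \<open>w\<close> to
  \<open>v\<close>, which the edge \<open>vw\<close> closes to a cycle of length 8; likewise at the other end. But a
  graph whose longest even cycle of length at most 12 has length 6 contains neither. Thus
  \<open>w\<close> lies on the path at distance at least 2 from both ends, and its neighbours there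
  are not \<open>u\<close> or \<open>v\<close>. Both cycles arise from \<open>closed_path_cycle\<close>; the two shortened paths from
  \<open>is_path_drop\<close> and \<open>is_path_take\<close>.\<close>

lemma path_edges_append_subset:
  "path_edges xs \<union> path_edges ys \<subseteq> path_edges (xs @ ys)"
  by (cases "xs = []"; cases "ys = []") (auto simp: path_edges_append)

lemma is_path_take: "is_path G p \<Longrightarrow> 0 < n \<Longrightarrow> is_path G (take n p)"
  using path_edges_append_subset[of "take n p" "drop n p"] set_take_subset[of n p]
  by (auto simp: is_path_def)

lemma is_path_drop: "is_path G p \<Longrightarrow> n < length p \<Longrightarrow> is_path G (drop n p)"
  using path_edges_append_subset[of "take n p" "drop n p"] set_drop_subset[of n p]
  by (auto simp: is_path_def)

lemma path_edges_nth: "Suc i < length p \<Longrightarrow> {p ! i, p ! Suc i} \<in> path_edges p"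
proof (induction p arbitrary: i rule: path_edges.induct)
  case (1 x y zs)
  then show ?case by (cases i) auto
qed auto

lemma is_path_adjacent_nth:
  "is_path G p \<Longrightarrow> Suc i < length p \<Longrightarrow> adjacent G (p ! i) (p ! Suc i)"
  using path_edges_nth[of i p] by (auto simp: is_path_def adjacent_def)

lemma adjacent_commute: "adjacent G x y \<longleftrightarrow> adjacent G y x"
  by (simp add: adjacent_def insert_commute)

lemma closed_path_cycle:
  assumes "is_path G p" "adjacent G (last p) (hd p)" "3 \<le> length p"
  shows "cycle_of_length (length p) G (cycle_graph p)"
  using assms
  by (auto simp: cycle_of_length_def is_path_def subgraph_def cycle_graph_def adjacent_def
      intro!: exI[of _ p])

lemma simple_graph_neighbour:
  assumes "simple_graph G" "w \<in> neighbourhood G u"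
  shows "w \<noteq> u" "w \<in> vertices G" "adjacent G u w"
  using assms by (fastforce simp: simple_graph_def neighbourhood_def adjacent_def)+

theorem lemma6p2:
  fixes G :: "'a graph" and u v w :: 'a
  assumes "simple_graph G"
    and "k_connected 2 G"
    and "uniquely_cycle_saturated 9 G"
    and "card (vertices G) \<ge> 9"
    and "longest_even_cycle_upto 12 G 6"
    and "u \<in> vertices G" and "v \<in> vertices G" and "u \<noteq> v" and "\<not> adjacent G u v"
    and "w \<in> neighbourhood G u" and "w \<in> neighbourhood G v"
  shows "w \<in> interior_vertices (the_nine_path G u v) \<and>
    (\<exists>i < length (the_nine_path G u v).
       the_nine_path G u v ! i = w \<and>
       num_edges (take (Suc i) (the_nine_path G u v)) \<ge> 2 \<and>
       num_edges (drop i (the_nine_path G u v)) \<ge> 2 \<and>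
       the_nine_path G u v ! (i - 1) \<in> neighbourhood G w - {u, v} \<and>
       the_nine_path G u v ! (i + 1) \<in> neighbourhood G w - {u, v})"
proof -
  define P where "P = the_nine_path G u v"
  have "nine_path G u v P"
    unfolding P_def the_nine_path_def by (rule theI', rule nine_path_unique) (use assms in auto)
  then have P: "is_path G P" "hd P = u" "last P = v" "length P = 9" and "P \<noteq> []"
    by (auto simp: nine_path_def path_between_def is_path_def)
  then have ends: "P ! 0 = u" "P ! 8 = v"
    by (simp_all add: hd_conv_nth last_conv_nth)
  have w: "w \<noteq> u" "w \<noteq> v" "w \<in> vertices G" "adjacent G u w" "adjacent G v w"
    using simple_graph_neighbour assms by metis+
  have no_cycle: "\<not> cycle_of_length k G C" if "even k" "6 < k" "k \<le> 12" for k C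
    using assms(5) that by (force simp: longest_even_cycle_upto_def)
  have "w \<in> set P"
  proof (rule ccontr)
    assume "w \<notin> set P"
    then have "is_path G (w # P)"
      using P \<open>P \<noteq> []\<close> w by (cases P) (auto simp: is_path_def adjacent_def insert_commute)
    then have "cycle_of_length 10 G (cycle_graph (w # P))"
      using closed_path_cycle[of G "w # P"] P \<open>P \<noteq> []\<close> w by simp
    then show False using no_cycle by simp
  qed
  then obtain i where i: "i < 9" "P ! i = w"
    using P by (metis in_set_conv_nth)
  have "i \<noteq> 0" "i \<noteq> 8" using i ends w by metis+
  moreover have "i \<noteq> 1"
  proof
    assume "i = 1"
    then have "cycle_of_length 8 G (cycle_graph (drop 1 P))"
      using closed_path_cycle[of G "drop 1 P"] is_path_drop[of G P 1] P i w
      by (simp add: hd_drop_conv_nth)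
    then show False using no_cycle by simp
  qed
  moreover have "i \<noteq> 7"
  proof
    assume "i = 7"
    then have "last (take 8 P) = w" "hd (take 8 P) = u"
      using P i \<open>P \<noteq> []\<close> by (simp_all add: last_conv_nth)
    then have "cycle_of_length 8 G (cycle_graph (take 8 P))"
      using closed_path_cycle[of G "take 8 P"] is_path_take[of G P 8] P w
      by (simp add: adjacent_commute)
    then show False using no_cycle by simp
  qed
  ultimately have i26: "2 \<le> i" "i \<le> 6" using i by auto
  have nth_ne: "P ! j \<notin> {u, v}" if "0 < j" "j < 8" for j
    using P that ends nth_eq_iff_index_eq[of P j 0] nth_eq_iff_index_eq[of P j 8]
    by (auto simp: is_path_def)
  have nth_V: "P ! j \<in> vertices G" if "j < 9" for j
    using P that by (auto simp: is_path_def)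
  have "P ! (i - 1) \<in> neighbourhood G w - {u, v}"
    using is_path_adjacent_nth[of G P "i - 1"] nth_ne[of "i - 1"] nth_V[of "i - 1"] P i i26
    by (simp add: neighbourhood_def adjacent_commute)
  moreover have "P ! (i + 1) \<in> neighbourhood G w - {u, v}"
    using is_path_adjacent_nth[of G P i] nth_ne[of "i + 1"] nth_V[of "i + 1"] P i i26
    by (simp add: neighbourhood_def)
  moreover have "w \<in> interior_vertices P"
    using \<open>w \<in> set P\<close> w P by (simp add: interior_vertices_def)
  ultimately show ?thesis
    using i i26 P unfolding P_def[symmetric] by (auto simp: num_edges_def intro!: exI[of _ i])
qed

end
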